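(* Let $u$ be a number and let $T$ be a linear operator on the space $\mathbb{P}$ of polynomials with $\deg(T(p))=\deg(p)-1$ for every polynomial $p$ (so $T$ annihilates constants). Let $(r_{n,u})_{n\ge0}$ be the unique sequence of polynomials such that $r_{0,u}=1$, $\deg r_{n,u}=n$, and $T(r_{n,u})=r_{n-1,u}$, $r_{n,u}(u)=0$ for $n\ge 1$. Assume that there are numbers $a_j$, $j\ge 1$, with $a_1=u$ and $r_{n,u}(x)=\sigma_n\prod_{j=1}^n(x-a_j)$ for $n\ge1$ (and $\sigma_0=1$). Let $(\hat p_n)_{n\ge0}$ be the sequence of monic orthogonal polynomials with respect to the measure $\mu$. Then $$\int\cdots\int \Lambda^2(\mathbf{x})\prod_{j=1}^{m}r_{n,u}(x_j)\,d\mu(\mathbf{x})=C_{T,n,m}\det\left(T^{i-1}(\hat p_{m+j-1})(u)\right)_{i,j=1}^n,$$ where $$C_{T,n,m}=(-1)^{mn}\,m!\,\sigma_n^m\prod_{j=0}^{m-1}\Vert\hat p_j\Vert^2\prod_{j=0}^{n-1}\sigma_j.$$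
   Context: Here $n$ and $m$ are nonnegative integers ($m$ is the number of variables), $\mathbf{x}=(x_1,\dots,x_m)$, $d\mu(\mathbf{x})=d\mu(x_1)\cdots d\mu(x_m)$, and $\Lambda(\mathbf{x})=\prod_{1\le i<j\le m}(x_i-x_j)$. Empty products and $0\times0$ determinants equal $1$. Measures are (possibly signed) measures on the real line with finite moments of all orders. Monic orthogonal polynomials: $\hat p_n$ is monic of degree $n$ and $\int\hat p_n\overline{\hat p_j}\,d\mu=0$ for $0\le j<n$; $\Vert\hat p_n\Vert^2=\int\hat p_n\overline{\hat p_n}\,d\mu$. $T^k$ denotes the $k$-fold composition of $T$, and $T^{k}(p)(u)$ is the value at $u$ of the polynomial $T^k(p)$. *)

theory Defs
  imports "HOL-Analysis.Analysis" "Jordan_Normal_Form.Determinant"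
begin

section \<open>Signed measures on the real line\<close>

definition signed_measure :: "(real set \<Rightarrow> real) \<Rightarrow> bool" where
  "signed_measure \<mu> \<longleftrightarrow> \<mu> {} = 0 \<and>
     (\<forall>A. range A \<subseteq> sets borel \<longrightarrow> disjoint_family A \<longrightarrow> (\<lambda>i. \<mu> (A i)) sums \<mu> (\<Union>i::nat. A i))"

text \<open>
  The two variations of a signed measure: \<open>sup {\<mu> B | B \<subseteq> A}\<close> and
  \<open>sup {- \<mu> B | B \<subseteq> A}\<close>, the supremum being over Borel sets. Negative values of
  \<open>\<mu> B\<close> are truncated to \<open>0\<close> by \<open>ennreal\<close>; this does not change the supremum, as
  \<open>B = {}\<close> is admitted.
\<close>

definition upper_variation :: "(real set \<Rightarrow> real) \<Rightarrow> real measure" where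
  "upper_variation \<mu> =
     measure_of UNIV (sets borel) (\<lambda>A. SUP B \<in> {B \<in> sets borel. B \<subseteq> A}. ennreal (\<mu> B))"

definition lower_variation :: "(real set \<Rightarrow> real) \<Rightarrow> real measure" where
  "lower_variation \<mu> = upper_variation (\<lambda>A. - \<mu> A)"

definition finite_moments :: "(real set \<Rightarrow> real) \<Rightarrow> bool" where
  "finite_moments \<mu> \<longleftrightarrow>
     (\<forall>k::nat. integrable (upper_variation \<mu>) (\<lambda>x. x ^ k) \<and>
               integrable (lower_variation \<mu>) (\<lambda>x. x ^ k))"

definition signed_integral :: "(real set \<Rightarrow> real) \<Rightarrow> (real \<Rightarrow> complex) \<Rightarrow> complex" where
  "signed_integral \<mu> f =
     integral\<^sup>L (upper_variation \<mu>) f - integral\<^sup>L (lower_variation \<mu>) f"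

text \<open>
  The \<open>m\<close>-fold integral of a function of the variables \<open>x 1, \<dots>, x m\<close>; the function
  must not depend on the other values of \<open>x\<close>, which are set to \<open>0\<close>.
\<close>

primrec multi_integral ::
  "(real set \<Rightarrow> real) \<Rightarrow> nat \<Rightarrow> ((nat \<Rightarrow> real) \<Rightarrow> complex) \<Rightarrow> complex" where
  "multi_integral \<mu> 0 F = F (\<lambda>_. 0)"
| "multi_integral \<mu> (Suc m) F =
     signed_integral \<mu> (\<lambda>t. multi_integral \<mu> m (\<lambda>x. F (x(Suc m := t))))"

subsection \<open>Adequacy of the variations\<close>

lemma sets_upper_variation [simp, measurable_cong]: "sets (upper_variation \<mu>) = sets borel"
  by (simp add: upper_variation_def sets.sigma_sets_eq[of borel, simplified])

lemma space_upper_variation [simp]: "space (upper_variation \<mu>) = UNIV"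
  by (simp add: upper_variation_def)

lemma sets_lower_variation [simp, measurable_cong]: "sets (lower_variation \<mu>) = sets borel"
  by (simp add: lower_variation_def)

lemma space_lower_variation [simp]: "space (lower_variation \<mu>) = UNIV"
  by (simp add: lower_variation_def)

lemma signed_measure_uminus: "signed_measure \<mu> \<Longrightarrow> signed_measure (\<lambda>A. - \<mu> A)"
  by (auto simp: signed_measure_def intro!: sums_minus)

lemma signed_measure_Un:
  assumes "signed_measure \<mu>" "A \<in> sets borel" "B \<in> sets borel" "A \<inter> B = {}"
  shows "\<mu> (A \<union> B) = \<mu> A + \<mu> B"
proof -
  let ?F = "\<lambda>i. \<mu> (binaryset A B i)"
  have "?F sums \<mu> (\<Union>i. binaryset A B i)"
  proof -
    have "range (binaryset A B) \<subseteq> sets borel"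
      using assms by (auto simp: binaryset_def)
    moreover have "disjoint_family (binaryset A B)"
      using assms(4) by (auto simp: disjoint_family_on_def binaryset_def)
    ultimately show ?thesis
      using assms(1) unfolding signed_measure_def by blast
  qed
  moreover have "?F sums (\<mu> A + \<mu> B)"
    using assms(1) binaryset_sums[of \<mu> A B] by (simp add: signed_measure_def)
  ultimately show ?thesis
    by (simp add: UN_binaryset_eq sums_unique2)
qed

lemma emeasure_upper_variation:
  assumes \<mu>: "signed_measure \<mu>" and A: "A \<in> sets borel"
  shows "emeasure (upper_variation \<mu>) A = (SUP B \<in> {B \<in> sets borel. B \<subseteq> A}. ennreal (\<mu> B))"
proof -
  define f where "f = (\<lambda>A. SUP B \<in> {B \<in> sets borel. B \<subseteq> A}. ennreal (\<mu> B))"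
  have \<mu>0: "\<mu> {} = 0" using \<mu> by (simp add: signed_measure_def)
  have f_upper: "ennreal (\<mu> B) \<le> f A" if "B \<in> sets borel" "B \<subseteq> A" for A B
    unfolding f_def using that by (auto intro!: SUP_upper)
  have f0: "f {} = 0"
    unfolding f_def using \<mu>0 by (auto intro!: antisym SUP_least)
  have fmono: "f A \<le> f B" if "A \<subseteq> B" for A B
    unfolding f_def by (rule SUP_subset_mono) (use that in auto)
  have add: "f A + f B \<le> f (A \<union> B)"
    if "A \<in> sets borel" "B \<in> sets borel" "A \<inter> B = {}" for A B
  proof -
    let ?S = "\<lambda>A. {C \<in> sets borel. C \<subseteq> A}"
    have pt: "ennreal (\<mu> C) + ennreal (\<mu> D) \<le> f (A \<union> B)"
      if C: "C \<in> ?S A" and D: "D \<in> ?S B" for C D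
    proof -
      consider "\<mu> C \<ge> 0" "\<mu> D \<ge> 0" | "\<mu> C < 0" | "\<mu> D < 0" by linarith
      then show ?thesis
      proof cases
        case 1
        have "ennreal (\<mu> C) + ennreal (\<mu> D) = ennreal (\<mu> (C \<union> D))"
          using 1 C D \<open>A \<inter> B = {}\<close> by (subst signed_measure_Un[OF \<mu>]) auto
        then show ?thesis using f_upper[of "C \<union> D" "A \<union> B"] C D by auto
      next
        case 2
        then show ?thesis using f_upper[of D "A \<union> B"] D by (auto simp: ennreal_neg)
      next
        case 3
        then show ?thesis using f_upper[of C "A \<union> B"] C by (auto simp: ennreal_neg)
      qed
    qed
    have ne: "?S A \<noteq> {}" "?S B \<noteq> {}" by auto
    have "f A + f B = (SUP D\<in>?S B. SUP C\<in>?S A. ennreal (\<mu> C) + ennreal (\<mu> D))"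
      unfolding f_def
      by (simp only: ennreal_SUP_add_left[OF ne(1), symmetric] ennreal_SUP_add_right[OF ne(2)])
    also have "\<dots> \<le> f (A \<union> B)"
      by (intro SUP_least pt)
    finally show ?thesis .
  qed
  have sup_add: "(\<Sum>i<N. f (A i)) \<le> f (\<Union>i<N. A i)"
    if "range A \<subseteq> sets borel" "disjoint_family A" for A :: "nat \<Rightarrow> real set" and N
  proof (induction N)
    case (Suc N)
    have dis: "(\<Union>i<N. A i) \<inter> A N = {}"
    proof -
      have "A i \<inter> A N = {}" if "i < N" for i
        using that by (intro disjoint_family_onD[OF \<open>disjoint_family A\<close>]) auto
      then show ?thesis by blast
    qed
    have "(\<Sum>i<Suc N. f (A i)) \<le> f (\<Union>i<N. A i) + f (A N)"
      using Suc by (simp add: add_right_mono)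
    also have "\<dots> \<le> f ((\<Union>i<N. A i) \<union> A N)"
      using that dis by (intro add) auto
    finally show ?case by (simp add: lessThan_Suc Un_commute)
  qed (simp add: f0)
  have ca: "countably_additive (sets borel) f"
  proof (rule countably_additiveI)
    fix A :: "nat \<Rightarrow> real set"
    assume A: "range A \<subseteq> sets borel" "disjoint_family A"
    show "(\<Sum>i. f (A i)) = f (\<Union>i. A i)"
    proof (rule antisym)
      have "(\<Sum>i<N. f (A i)) \<le> f (\<Union>i. A i)" for N
        by (rule order_trans[OF sup_add[OF A]]) (auto intro!: fmono)
      then show "(\<Sum>i. f (A i)) \<le> f (\<Union>i. A i)"
        by (intro suminf_le_const) auto
    next
      show "f (\<Union>i. A i) \<le> (\<Sum>i. f (A i))"
      proof (subst f_def, rule SUP_least)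
        fix B assume "B \<in> {B \<in> sets borel. B \<subseteq> (\<Union>i. A i)}"
        then have B: "B \<in> sets borel" "B = (\<Union>i. B \<inter> A i)" by auto
        have "(\<lambda>i. \<mu> (B \<inter> A i)) sums \<mu> (\<Union>i. B \<inter> A i)"
        proof -
          have "range (\<lambda>i. B \<inter> A i) \<subseteq> sets borel" using A(1) B(1) by auto
          moreover have "disjoint_family (\<lambda>i. B \<inter> A i)"
            using A(2) by (rule disjoint_family_on_bisimulation) auto
          ultimately show ?thesis using \<mu> unfolding signed_measure_def by blast
        qed
        then have s: "(\<lambda>i. \<mu> (B \<inter> A i)) sums \<mu> B" using B(2) by simp
        then have "(\<lambda>N. ennreal (\<Sum>i<N. \<mu> (B \<inter> A i))) \<longlonglongrightarrow> ennreal (\<mu> B)"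
          unfolding sums_def by (rule tendsto_ennrealI)
        moreover have "ennreal (\<Sum>i<N. \<mu> (B \<inter> A i)) \<le> (\<Sum>i. f (A i))" for N
        proof -
          have "ennreal (\<Sum>i<N. \<mu> (B \<inter> A i)) \<le> ennreal (\<Sum>i<N. max 0 (\<mu> (B \<inter> A i)))"
            by (intro ennreal_leI sum_mono) auto
          also have "\<dots> = (\<Sum>i<N. ennreal (max 0 (\<mu> (B \<inter> A i))))"
            by (rule sum_ennreal[symmetric]) auto
          also have "\<dots> = (\<Sum>i<N. ennreal (\<mu> (B \<inter> A i)))"
            by (intro sum.cong) (auto simp: max_def ennreal_neg)
          also have "\<dots> \<le> (\<Sum>i<N. f (A i))"
            using A B(1) by (intro sum_mono f_upper) auto
          also have "\<dots> \<le> (\<Sum>i. f (A i))"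
            by (intro sum_le_suminf) auto
          finally show ?thesis .
        qed
        ultimately show "ennreal (\<mu> B) \<le> (\<Sum>i. f (A i))"
          by (intro LIMSEQ_le_const2) auto
      qed
    qed
  qed
  have "emeasure (upper_variation \<mu>) A = f A"
  proof (rule emeasure_measure_of)
    show "upper_variation \<mu> = measure_of UNIV (sets borel) f"
      by (simp add: upper_variation_def f_def)
    show "positive (sets (upper_variation \<mu>)) f"
      using f0 by (simp add: positive_def)
    show "countably_additive (sets (upper_variation \<mu>)) f"
      using ca by simp
    show "A \<in> sets (upper_variation \<mu>)" using A by simp
  qed simp
  then show ?thesis by (simp add: f_def)
qed

lemma Jordan_decomposition:
  assumes \<mu>: "signed_measure \<mu>" "finite_moments \<mu>" and A: "A \<in> sets borel"
  shows "\<mu> A = measure (upper_variation \<mu>) A - measure (lower_variation \<mu>) A"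
proof -
  let ?P = "upper_variation \<mu>" and ?N = "lower_variation \<mu>"
  have "integrable ?P (\<lambda>x. x ^ 0)" "integrable ?N (\<lambda>x. x ^ 0)"
    using \<mu>(2) unfolding finite_moments_def by blast+
  then have "integrable ?P (indicator UNIV :: real \<Rightarrow> real)"
    "integrable ?N (indicator UNIV :: real \<Rightarrow> real)"
    by (simp_all add: indicator_def[abs_def])
  then have fin: "emeasure ?P UNIV < \<infinity>" "emeasure ?N UNIV < \<infinity>"
    unfolding integrable_indicator_iff by simp_all
  interpret P: finite_measure ?P
    using fin(1) by (intro finite_measureI) auto
  interpret N: finite_measure ?N
    using fin(2) by (intro finite_measureI) auto
  have eP: "ennreal (measure ?P A) = (SUP B \<in> {B \<in> sets borel. B \<subseteq> A}. ennreal (\<mu> B))"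
    using emeasure_upper_variation[OF \<mu>(1) A] by (simp add: P.emeasure_eq_measure)
  have eN: "ennreal (measure ?N A) = (SUP B \<in> {B \<in> sets borel. B \<subseteq> A}. ennreal (- \<mu> B))"
    using emeasure_upper_variation[OF signed_measure_uminus[OF \<mu>(1)] A]
    by (simp add: N.emeasure_eq_measure flip: lower_variation_def)
  have split: "\<mu> A = \<mu> B + \<mu> (A - B)" if "B \<in> sets borel" "B \<subseteq> A" for B
  proof -
    have "\<mu> (B \<union> (A - B)) = \<mu> B + \<mu> (A - B)"
      using that A by (intro signed_measure_Un[OF \<mu>(1)]) auto
    moreover have "B \<union> (A - B) = A" using that by auto
    ultimately show ?thesis by simp
  qed
  have ubP: "\<mu> B \<le> measure ?P A" and ubN: "- \<mu> B \<le> measure ?N A"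
    if "B \<in> sets borel" "B \<subseteq> A" for B
  proof -
    have "ennreal (\<mu> B) \<le> ennreal (measure ?P A)" "ennreal (- \<mu> B) \<le> ennreal (measure ?N A)"
      unfolding eP eN using that by (auto intro!: SUP_upper)
    then show "\<mu> B \<le> measure ?P A" "- \<mu> B \<le> measure ?N A"
      by (auto simp: ennreal_le_iff)
  qed
  have posN: "0 \<le> \<mu> A + measure ?N A" and posP: "0 \<le> measure ?P A - \<mu> A"
    using ubN[of A] ubP[of A] A by auto
  have "ennreal (measure ?P A) \<le> ennreal (\<mu> A + measure ?N A)"
    unfolding eP
  proof (rule SUP_least)
    fix B assume B: "B \<in> {B \<in> sets borel. B \<subseteq> A}"
    show "ennreal (\<mu> B) \<le> ennreal (\<mu> A + measure ?N A)"
      using split[of B] ubN[of "A - B"] A B by (intro ennreal_leI) auto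
  qed
  moreover have "ennreal (measure ?N A) \<le> ennreal (measure ?P A - \<mu> A)"
    unfolding eN
  proof (rule SUP_least)
    fix B assume B: "B \<in> {B \<in> sets borel. B \<subseteq> A}"
    show "ennreal (- \<mu> B) \<le> ennreal (measure ?P A - \<mu> A)"
      using split[of B] ubP[of "A - B"] A B by (intro ennreal_leI) auto
  qed
  ultimately show ?thesis using posN posP by (simp add: ennreal_le_iff)
qed

section \<open>Orthogonal polynomials and the degree-lowering operator\<close>

definition norm_sq :: "(real set \<Rightarrow> real) \<Rightarrow> complex poly \<Rightarrow> complex" where
  "norm_sq \<mu> p = signed_integral \<mu> (\<lambda>x. poly p (of_real x) * cnj (poly p (of_real x)))"

definition monic_orthogonal :: "(real set \<Rightarrow> real) \<Rightarrow> (nat \<Rightarrow> complex poly) \<Rightarrow> bool" where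
  "monic_orthogonal \<mu> p \<longleftrightarrow>
     (\<forall>n. degree (p n) = n \<and> lead_coeff (p n) = 1 \<and>
        (\<forall>j<n. signed_integral \<mu> (\<lambda>x. poly (p n) (of_real x) * cnj (poly (p j) (of_real x))) = 0))"

text \<open>
  In the library \<open>degree 0 = 0\<close>, so \<open>degree (T p) = degree p - 1\<close> alone would allow \<open>T\<close>
  to annihilate a polynomial of degree \<open>1\<close> and to map constants to nonzero constants.
\<close>

definition lowers_degree :: "(complex poly \<Rightarrow> complex poly) \<Rightarrow> bool" where
  "lowers_degree T \<longleftrightarrow>
     (\<forall>p. (degree p = 0 \<longrightarrow> T p = 0) \<and>
          (degree p > 0 \<longrightarrow> T p \<noteq> 0 \<and> degree (T p) = degree p - 1))"

definition canonical_sequence ::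
  "(complex poly \<Rightarrow> complex poly) \<Rightarrow> complex \<Rightarrow> (nat \<Rightarrow> complex poly) \<Rightarrow> bool" where
  "canonical_sequence T u r \<longleftrightarrow>
     r 0 = 1 \<and> (\<forall>n. degree (r n) = n) \<and>
     (\<forall>n\<ge>1. T (r n) = r (n - 1) \<and> poly (r n) u = 0)"

definition difference_product :: "nat \<Rightarrow> (nat \<Rightarrow> real) \<Rightarrow> real" where
  "difference_product m x = (\<Prod>(i, j) \<in> {(i, j). 1 \<le> i \<and> i < j \<and> j \<le> m}. x i - x j)"

end

(*
  The functionals phi_k(q) = T^k(q)(u) form the basis dual to (r_k), so the determinant on the
  right collects the coefficients of the p_(m+j) in the expansion along r_0, ..., r_(n-1). These
  functionals vanish on multiples of g = (x - a_1)...(x - a_n) when k < n, because such a multiple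
  is a combination of the r_k with k >= n. Let L be integration against mu and consider, on the
  polynomials of degree below m + n, the functionals L(x^i .) for i < m together with phi_k for
  k < n. Their matrix in the basis p_0, ..., p_(m+n-1) is block triangular with diagonal blocks of
  determinants prod ||p_j||^2 and det(phi_i(p_(m+j))). Their matrix in the basis r_0, ..., r_(n-1),
  g, g x, ..., g x^(m-1) is, up to a rotation of the columns with sign (-1)^(mn), block triangular
  with diagonal blocks the Hankel matrix L(g x^(i+j)) and the identity. The two bases have
  determinants 1 and sigma_0 ... sigma_(n-1) relative to the monomials, and Heine's formula
  identifies the Hankel determinant with the multiple integral. Nothing is divided by a norm, so
  vanishing norms (possible for signed measures) do no harm.
*)
theory Submission
  imports Defs
begin

section \<open>Determinants of linear functionals on polynomials\<close>

lemma degree_prod_monic_linear: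
  "degree (\<Prod>j\<in>A. [:- a j, 1 :: 'a::idom:]) = card A"
  by (subst degree_prod_eq_sum_degree) auto

lemma lead_coeff_prod_monic_linear:
  "lead_coeff (\<Prod>j\<in>A. [:- a j, 1 :: 'a::idom:]) = 1"
  by (subst lead_coeff_prod) simp

lemma module_smult: "Modules.module (Polynomial.smult :: 'a::comm_ring_1 \<Rightarrow> _)"
  by unfold_locales (simp_all add: smult_add_right smult_add_left)

lemma module_mult: "Modules.module ((*) :: 'a::comm_ring_1 \<Rightarrow> _)"
  by unfold_locales (simp_all add: algebra_simps)

text \<open>The scalars need not form a field, so functionals are encoded as
  \<open>module_hom\<close>.\<close>

lemma poly_functionalI:
  fixes \<psi> :: "'a::comm_ring_1 poly \<Rightarrow> 'a"
  assumes "\<And>p q. \<psi> (p + q) = \<psi> p + \<psi> q" "\<And>c p. \<psi> (Polynomial.smult c p) = c * \<psi> p"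
  shows "module_hom Polynomial.smult (*) \<psi>"
  using assms by (simp add: module_hom_iff module_smult module_mult)

lemma poly_functional_comp_mult:
  fixes \<psi> :: "'a::comm_ring_1 poly \<Rightarrow> 'a"
  assumes "module_hom Polynomial.smult (*) \<psi>"
  shows "module_hom Polynomial.smult (*) (\<lambda>q. \<psi> (g * q))"
  using assms by (intro poly_functionalI) (simp_all add: module_hom_iff distrib_left)

text \<open>Subtracting a multiple of the monic \<open>b (d - 1)\<close> removes the top coefficient
  of \<open>q\<close>, which permits induction on \<open>d\<close>. The bound on \<open>q\<close> is
  stated through coefficients because for \<open>d = 0\<close> it must force \<open>q = 0\<close>,
  which no bound on \<open>degree\<close> expresses.\<close>

lemma poly_functional_eq_0:
  fixes \<psi> :: "'a::comm_ring_1 poly \<Rightarrow> 'a"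
  assumes \<psi>: "module_hom Polynomial.smult (*) \<psi>"
    and deg: "\<And>k. k < d \<Longrightarrow> degree (b k) = k" and monic: "\<And>k. k < d \<Longrightarrow> lead_coeff (b k) = 1"
    and zero: "\<And>k. k < d \<Longrightarrow> \<psi> (b k) = 0"
    and q: "\<And>i. i \<ge> d \<Longrightarrow> coeff q i = 0"
  shows "\<psi> q = 0"
  using deg monic zero q
proof (induction d arbitrary: q)
  interpret module_hom Polynomial.smult "(*)" \<psi> by (fact \<psi>)
  {
    case 0
    then have "q = 0" by (intro poly_eqI) auto
    then show ?case by simp
  next
    case (Suc d)
    define q' where "q' = q - Polynomial.smult (coeff q d) (b d)"
    have q': "coeff q' i = 0" if "i \<ge> d" for i
    proof (cases "i = d")
      case True
      then show ?thesis using Suc.prems(1)[of d] Suc.prems(2)[of d] by (simp add: q'_def)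
    next
      case False
      with that have "degree (b d) < i" using Suc.prems(1)[of d] by simp
      then show ?thesis using False that Suc.prems(4)[of i] by (simp add: q'_def coeff_eq_0)
    qed
    have "\<psi> q' = 0"
      by (rule Suc.IH) (use Suc.prems(1-3) q' in auto)
    then show ?case using Suc.prems(3)[of d] by (simp add: q'_def diff scale)
  }
qed

text \<open>The transition matrix from the monomials to a basis with \<open>degree (b j) = j\<close>
  is upper triangular, with the leading coefficients on its diagonal.\<close>

lemma det_functionals_triangular_basis:
  fixes \<psi> :: "nat \<Rightarrow> 'a::idom poly \<Rightarrow> 'a"
  assumes \<psi>: "\<And>i. i < N \<Longrightarrow> module_hom Polynomial.smult (*) (\<psi> i)"
    and deg: "\<And>j. j < N \<Longrightarrow> degree (b j) = j"
  shows "Determinant.det (Matrix.mat N N (\<lambda>(i, j). \<psi> i (b j))) =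
    (\<Prod>j<N. lead_coeff (b j)) * Determinant.det (Matrix.mat N N (\<lambda>(i, j). \<psi> i (monom 1 j)))"
proof -
  let ?M = "Matrix.mat N N (\<lambda>(i, j). \<psi> i (monom 1 j))"
  let ?U = "Matrix.mat N N (\<lambda>(k, j). coeff (b j) k)"
  have expand: "\<psi> i (b j) = (\<Sum>k = 0..<N. \<psi> i (monom 1 k) * coeff (b j) k)"
    if "i < N" "j < N" for i j
  proof -
    interpret module_hom Polynomial.smult "(*)" "\<psi> i" by (rule \<psi>) fact
    have "b j = (\<Sum>k\<le>N - 1. monom (coeff (b j) k) k)"
      using that deg[of j] by (intro poly_as_sum_of_monoms'[symmetric]) auto
    also have "{..N - 1} = {0..<N}" using that by auto
    finally have "b j = (\<Sum>k = 0..<N. Polynomial.smult (coeff (b j) k) (monom 1 k))"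
      by (simp add: smult_monom)
    then have "\<psi> i (b j) = \<psi> i (\<Sum>k = 0..<N. Polynomial.smult (coeff (b j) k) (monom 1 k))"
      by simp
    then show ?thesis by (simp add: sum scale mult.commute)
  qed
  have "Matrix.mat N N (\<lambda>(i, j). \<psi> i (b j)) = ?M * ?U"
    by (rule eq_matI) (auto simp: expand scalar_prod_def)
  moreover have "Determinant.det ?U = (\<Prod>j<N. lead_coeff (b j))"
  proof -
    have "Determinant.det ?U = prod_list (diag_mat ?U)"
      by (rule det_upper_triangular[where n = N])
         (auto simp: upper_triangular_def deg coeff_eq_0)
    then show ?thesis
      by (simp add: prod_list_diag_prod deg lessThan_atLeast0)
  qed
  ultimately show ?thesis
    by (simp add: Determinant.det_mult[where n = N] mult.commute)
qed

text \<open>In the Newton basis \<open>\<Prod>k<j. (X - x k)\<close> the Vandermonde matrix becomes triangular.\<close>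

lemma det_Vandermonde:
  fixes x :: "nat \<Rightarrow> 'a::idom"
  shows "Determinant.det (Matrix.mat m m (\<lambda>(i, j). x i ^ j)) = (\<Prod>i<m. \<Prod>k<i. x i - x k)"
proof -
  define b where "b = (\<lambda>j. \<Prod>k<j. [:- x k, 1:])"
  have deg: "degree (b j) = j" for j
    by (simp add: b_def degree_prod_monic_linear)
  have monic: "lead_coeff (b j) = 1" for j
    unfolding b_def by (rule lead_coeff_prod_monic_linear)
  let ?N = "Matrix.mat m m (\<lambda>(i, j). poly (b j) (x i))"
  have "Determinant.det ?N = Determinant.det (Matrix.mat m m (\<lambda>(i, j). poly (monom 1 j) (x i)))"
    using monic deg
    by (subst det_functionals_triangular_basis) (auto intro!: poly_functionalI)
  also have "\<dots> = Determinant.det (Matrix.mat m m (\<lambda>(i, j). x i ^ j))"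
    by (simp add: poly_monom)
  finally have "Determinant.det (Matrix.mat m m (\<lambda>(i, j). x i ^ j)) = Determinant.det ?N" ..
  also have "\<dots> = prod_list (diag_mat ?N)"
    by (rule det_lower_triangular[where n = m]) (auto simp: b_def poly_prod)
  also have "\<dots> = (\<Prod>i<m. \<Prod>k<i. x i - x k)"
    by (simp add: prod_list_diag_prod b_def poly_prod lessThan_atLeast0)
  finally show ?thesis .
qed

text \<open>This is the purely algebraic core, a Christoffel-type formula: one determinant of
  functionals is computed in the bases \<open>p\<close> and \<open>b\<close>, which are compared
  through the monomials.\<close>

lemma det_Christoffel:
  fixes L :: "'a::idom poly \<Rightarrow> 'a" and \<phi> :: "nat \<Rightarrow> 'a poly \<Rightarrow> 'a"
  assumes L: "module_hom Polynomial.smult (*) L"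
    and \<phi>: "\<And>i. i < n \<Longrightarrow> module_hom Polynomial.smult (*) (\<phi> i)"
    and deg_p: "\<And>j. degree (p j) = j" and monic_p: "\<And>j. lead_coeff (p j) = 1"
    and orth: "\<And>i j. i < j \<Longrightarrow> L (monom 1 i * p j) = 0"
    and deg_r: "\<And>j. j < n \<Longrightarrow> degree (r j) = j"
    and dual: "\<And>i j. i < n \<Longrightarrow> j < n \<Longrightarrow> \<phi> i (r j) = (if i = j then 1 else 0)"
    and deg_g: "degree g = n" and monic_g: "lead_coeff g = 1"
    and ann: "\<And>i q. i < n \<Longrightarrow> \<phi> i (g * q) = 0"
  shows "Determinant.det (Matrix.mat m m (\<lambda>(i, j). L (g * monom 1 (i + j)))) =
    (- 1) ^ (m * n) * (\<Prod>j<n. lead_coeff (r j)) * (\<Prod>j<m. L (monom 1 j * p j)) *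
    Determinant.det (Matrix.mat n n (\<lambda>(i, j). \<phi> i (p (m + j))))"
proof -
  define \<psi> where "\<psi> = (\<lambda>i q. if i < m then L (monom 1 i * q) else \<phi> (i - m) q)"
  define b where "b = (\<lambda>j. if j < n then r j else g * monom 1 (j - n))"
  let ?D = "\<lambda>b. Determinant.det (Matrix.mat (m + n) (m + n) (\<lambda>(i, j). \<psi> i (b j)))"
  let ?H = "Matrix.mat m m (\<lambda>(i, j). L (g * monom 1 (i + j)))"
  let ?P = "Matrix.mat n n (\<lambda>(i, j). \<phi> i (p (m + j)))"
  have \<psi>: "module_hom Polynomial.smult (*) (\<psi> i)" if "i < m + n" for i
    using that L \<phi> by (cases "i < m") (simp_all add: \<psi>_def poly_functional_comp_mult)
  have g0: "g \<noteq> 0" using monic_g by auto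
  have deg_b: "degree (b j) = j" if "j < m + n" for j
    using that deg_r deg_g g0 by (auto simp: b_def degree_mult_eq monom_eq_0_iff degree_monom_eq)
  have "?D b = (\<Prod>j<m + n. lead_coeff (b j)) * ?D (monom 1)"
    by (rule det_functionals_triangular_basis[OF \<psi> deg_b])
  also have "?D (monom 1) = ?D p"
    using det_functionals_triangular_basis[of "m + n" \<psi> p, OF \<psi>] deg_p monic_p by simp
  also have "(\<Prod>j<m + n. lead_coeff (b j)) = (\<Prod>j<n. lead_coeff (r j))"
  proof -
    \<comment> \<open>From index \<open>n\<close> on, the elements
      \<open>g * monom 1 (j - n)\<close> are monic.\<close>
    have "(\<Prod>j<m + n. lead_coeff (b j)) = (\<Prod>j<n. lead_coeff (b j))"
      by (rule prod.mono_neutral_right)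
         (auto simp: b_def lead_coeff_mult monic_g degree_monom_eq)
    also have "\<dots> = (\<Prod>j<n. lead_coeff (r j))"
      by (intro prod.cong) (auto simp: b_def)
    finally show ?thesis .
  qed
  also have "?D p = (\<Prod>j<m. L (monom 1 j * p j)) * Determinant.det ?P"
  proof -
    let ?A = "Matrix.mat m m (\<lambda>(i, j). L (monom 1 i * p j))"
    \<comment> \<open>The upper right block vanishes by \<open>orth\<close>, since there the row
      index is below \<open>m\<close> and the column index is at least \<open>m\<close>.\<close>
    have "Matrix.mat (m + n) (m + n) (\<lambda>(i, j). \<psi> i (p j)) =
        four_block_mat ?A (0\<^sub>m m n) (Matrix.mat n m (\<lambda>(i, j). \<phi> i (p j))) ?P"
      by (rule eq_matI) (auto simp: \<psi>_def orth)
    then have "?D p = Determinant.det ?A * Determinant.det ?P"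
      by (simp add: det_four_block_mat_upper_right_zero[where n = m and m = n])
    also have "Determinant.det ?A = prod_list (diag_mat ?A)"
      by (rule det_lower_triangular[where n = m]) (auto simp: orth)
    finally show ?thesis
      by (simp add: prod_list_diag_prod lessThan_atLeast0)
  qed
  finally have Db: "?D b = (\<Prod>j<n. lead_coeff (r j)) *
    ((\<Prod>j<m. L (monom 1 j * p j)) * Determinant.det ?P)" .
  \<comment> \<open>A rotation moves the \<open>m\<close> columns of the multiples of
    \<open>g\<close> in front of the \<open>n\<close> columns of the \<open>r j\<close>; this is the
    source of the sign.\<close>
  have "?D b = (- 1) ^ (m * n) * Determinant.det (Matrix.mat (m + n) (m + n)
    (\<lambda>(i, j). \<psi> i (b (if j < m then j + n else j - m))))"
    by (subst det_swap_cols)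
       (auto intro!: arg_cong[where f = Determinant.det] eq_matI)
  \<comment> \<open>In the rows of \<open>\<phi>\<close>, \<open>ann\<close> gives the zero block
    and \<open>dual\<close> the identity block.\<close>
  also have "Matrix.mat (m + n) (m + n) (\<lambda>(i, j). \<psi> i (b (if j < m then j + n else j - m))) =
    four_block_mat ?H (Matrix.mat m n (\<lambda>(i, j). L (monom 1 i * r j))) (0\<^sub>m n m) (1\<^sub>m n)"
    by (rule eq_matI) (auto simp: \<psi>_def b_def ann dual mult_monom mult.left_commute)
  also have "Determinant.det \<dots> = Determinant.det ?H"
    by (simp add: det_four_block_mat_lower_left_zero[where n = m and m = n])
  finally have "Determinant.det ?H = (- 1) ^ (m * n) * ?D b"
    by (simp flip: mult.assoc power_add power_mult_distrib)
  then show ?thesis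
    by (simp add: Db mult.assoc)
qed

section \<open>Integrals of polynomials\<close>

text \<open>No conjugation occurs here: the functional is complex linear in \<open>q\<close>, so it
  fits the determinant lemmas.\<close>

definition poly_integral :: "(real set \<Rightarrow> real) \<Rightarrow> complex poly \<Rightarrow> complex" where
  "poly_integral \<mu> q = signed_integral \<mu> (\<lambda>x. poly q (of_real x))"

lemma integrable_poly:
  assumes "\<And>k. integrable M (\<lambda>x::real. x ^ k)"
  shows "integrable M (\<lambda>x. poly q (complex_of_real x))"
proof -
  have "integrable M (\<lambda>x. complex_of_real x ^ k)" for k
    using integrable_of_real[OF assms[of k], where 'a = complex] by simp
  then show ?thesis
    unfolding poly_altdef by auto
qed

lemma poly_functional_poly_integral:
  assumes "finite_moments \<mu>"
  shows "module_hom Polynomial.smult (*) (poly_integral \<mu>)"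
proof -
  have int: "integrable (upper_variation \<mu>) (\<lambda>x. poly q (complex_of_real x))"
    "integrable (lower_variation \<mu>) (\<lambda>x. poly q (complex_of_real x))" for q
    using assms by (auto simp: finite_moments_def intro!: integrable_poly)
  show ?thesis
    by (rule poly_functionalI)
       (simp_all add: poly_integral_def signed_integral_def int algebra_simps)
qed

text \<open>For sums of separated products every inner integral is a polynomial in the remaining
  variable, so linearity of the single integral suffices and no Fubini theorem enters.\<close>

lemma multi_integral_sum_prod:
  assumes fm: "finite_moments \<mu>"
  shows "multi_integral \<mu> m (\<lambda>x. \<Sum>s\<in>S. c s * (\<Prod>i<m. poly (f s i) (of_real (x (Suc i))))) =
    (\<Sum>s\<in>S. c s * (\<Prod>i<m. poly_integral \<mu> (f s i)))"
proof (induction m arbitrary: c)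
  interpret module_hom Polynomial.smult "(*)" "poly_integral \<mu>"
    using fm by (rule poly_functional_poly_integral)
  {
    case 0
    show ?case by simp
  next
    case (Suc m)
    let ?I = "\<lambda>s. \<Prod>i<m. poly_integral \<mu> (f s i)"
    have "multi_integral \<mu> m (\<lambda>x. \<Sum>s\<in>S. c s *
        (\<Prod>i<Suc m. poly (f s i) (of_real ((x(Suc m := t)) (Suc i))))) =
      poly (\<Sum>s\<in>S. Polynomial.smult (c s * ?I s) (f s m)) (of_real t)" for t
      \<comment> \<open>For fixed \<open>t\<close> the factor in the outermost variable is a
        constant and is absorbed into \<open>c\<close>.\<close>
      using Suc.IH[of "\<lambda>s. c s * poly (f s m) (of_real t)"]
      by (simp add: poly_sum mult_ac)
    then have "multi_integral \<mu> (Suc m) (\<lambda>x. \<Sum>s\<in>S. c s *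
        (\<Prod>i<Suc m. poly (f s i) (of_real (x (Suc i))))) =
      poly_integral \<mu> (\<Sum>s\<in>S. Polynomial.smult (c s * ?I s) (f s m))"
      by (simp add: poly_integral_def)
    then show ?case
      by (simp add: sum scale mult_ac)
  }
qed

section \<open>Heine's formula\<close>

lemma difference_product_square:
  "complex_of_real ((difference_product m x)\<^sup>2) =
    (Determinant.det (Matrix.mat m m (\<lambda>(i, j). of_real (x (Suc i)) ^ j)))\<^sup>2"
proof -
  let ?S = "SIGMA i:{..<m}. {..<i}"
  have "difference_product m x = (\<Prod>(i, k)\<in>?S. x (Suc k) - x (Suc i))"
    unfolding difference_product_def
    by (rule prod.reindex_bij_witness[of _ "\<lambda>(i, k). (Suc k, Suc i)" "\<lambda>(i, k). (k - 1, i - 1)"]) auto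
  then have "(difference_product m x)\<^sup>2 = (\<Prod>(i, k)\<in>?S. (x (Suc k) - x (Suc i))\<^sup>2)"
    by (simp add: case_prod_beta flip: prod_power_distrib)
  \<comment> \<open>The Vandermonde determinant has the opposite orientation of each difference; the
    squares make this harmless.\<close>
  also have "\<dots> = (\<Prod>(i, k)\<in>?S. (x (Suc i) - x (Suc k))\<^sup>2)"
    by (simp add: power2_commute)
  also have "\<dots> = (\<Prod>i<m. \<Prod>k<i. (x (Suc i) - x (Suc k))\<^sup>2)"
    by (simp add: prod.Sigma)
  finally have "complex_of_real ((difference_product m x)\<^sup>2) =
      (\<Prod>i<m. \<Prod>k<i. (complex_of_real (x (Suc i)) - of_real (x (Suc k)))\<^sup>2)"
    by simp
  then show ?thesis
    by (simp add: det_Vandermonde flip: prod_power_distrib)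
qed

text \<open>Expanding both Vandermonde determinants over permutations \<open>\<pi>\<close> and
  \<open>\<rho>\<close> separates the variables. For fixed \<open>\<pi>\<close>, the sum over
  \<open>\<rho>\<close> is the Hankel determinant with rows permuted by \<open>\<pi>\<close>. The
  sign of \<open>\<pi>\<close> then cancels, so each of the \<open>m!\<close> choices of
  \<open>\<pi>\<close> contributes equally.\<close>

lemma multi_integral_Heine:
  assumes fm: "finite_moments \<mu>"
  shows "multi_integral \<mu> m
      (\<lambda>x. of_real ((difference_product m x)\<^sup>2) * (\<Prod>j=1..m. poly w (of_real (x j)))) =
    fact m * Determinant.det (Matrix.mat m m (\<lambda>(i, j). poly_integral \<mu> (w * monom 1 (i + j))))"
proof -
  let ?Q = "{\<pi>. \<pi> permutes {0..<m}}"
  let ?f = "\<lambda>(\<pi>, \<rho>) i. w * monom 1 (\<pi> i + \<rho> i)"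
  let ?c = "\<lambda>(\<pi>, \<rho>). signof \<pi> * signof \<rho> :: complex"
  let ?H = "Matrix.mat m m (\<lambda>(i, j). poly_integral \<mu> (w * monom 1 (i + j)))"
  have "of_real ((difference_product m x)\<^sup>2) * (\<Prod>j=1..m. poly w (of_real (x j))) =
    (\<Sum>s\<in>?Q \<times> ?Q. ?c s * (\<Prod>i<m. poly (?f s i) (of_real (x (Suc i)))))" for x
  proof -
    let ?V = "Matrix.mat m m (\<lambda>(i, j). of_real (x (Suc i)) ^ j) :: complex mat"
    have V: "Determinant.det ?V = (\<Sum>\<pi>\<in>?Q. signof \<pi> * (\<Prod>i<m. of_real (x (Suc i)) ^ \<pi> i))"
      by (subst det_def'[of _ m])
         (auto intro!: sum.cong prod.cong simp: lessThan_atLeast0 permutes_in_image)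
    have W: "(\<Prod>j=1..m. poly w (of_real (x j))) = (\<Prod>i<m. poly w (of_real (x (Suc i))))"
      by (rule prod.reindex_bij_witness[of _ Suc "\<lambda>j. j - 1"]) auto
    have "of_real ((difference_product m x)\<^sup>2) * (\<Prod>j=1..m. poly w (of_real (x j))) =
      (\<Sum>\<pi>\<in>?Q. \<Sum>\<rho>\<in>?Q. (signof \<pi> * (\<Prod>i<m. of_real (x (Suc i)) ^ \<pi> i)) *
        (signof \<rho> * (\<Prod>i<m. of_real (x (Suc i)) ^ \<rho> i)) * (\<Prod>i<m. poly w (of_real (x (Suc i)))))"
      unfolding difference_product_square W
      unfolding power2_eq_square V sum_product by (simp only: sum_distrib_right)
    also have "\<dots> = (\<Sum>\<pi>\<in>?Q. \<Sum>\<rho>\<in>?Q. ?c (\<pi>, \<rho>) *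
        (\<Prod>i<m. poly (?f (\<pi>, \<rho>) i) (of_real (x (Suc i)))))"
      by (simp add: poly_monom power_add prod.distrib mult_ac)
    finally show ?thesis by (simp add: sum.cartesian_product case_prod_beta)
  qed
  then have "multi_integral \<mu> m
      (\<lambda>x. of_real ((difference_product m x)\<^sup>2) * (\<Prod>j=1..m. poly w (of_real (x j)))) =
    (\<Sum>s\<in>?Q \<times> ?Q. ?c s * (\<Prod>i<m. poly_integral \<mu> (?f s i)))"
    by (simp only: multi_integral_sum_prod[OF fm])
  also have "\<dots> = (\<Sum>\<pi>\<in>?Q. signof \<pi> *
      (\<Sum>\<rho>\<in>?Q. signof \<rho> * (\<Prod>i<m. poly_integral \<mu> (w * monom 1 (\<pi> i + \<rho> i)))))"
    by (simp add: sum.cartesian_product sum_distrib_left mult.assoc case_prod_beta)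
  also have "\<dots> = (\<Sum>\<pi>\<in>?Q. signof \<pi> *
      Determinant.det (Matrix.mat m m (\<lambda>(i, j). ?H $$ (\<pi> i, j))))"
    by (intro sum.cong refl arg_cong2[where f = "(*)"], subst det_def'[of _ m])
       (auto intro!: sum.cong prod.cong simp: lessThan_atLeast0 permutes_in_image)
  also have "\<dots> = (\<Sum>\<pi>\<in>?Q. Determinant.det ?H)"
  proof (intro sum.cong refl)
    fix \<pi> assume "\<pi> \<in> ?Q"
    then show "signof \<pi> * Determinant.det (Matrix.mat m m (\<lambda>(i, j). ?H $$ (\<pi> i, j))) =
        Determinant.det ?H"
      by (simp add: det_permute_rows[of ?H m] sign_def)
  qed
  also have "\<dots> = fact m * Determinant.det ?H"
    by (simp add: card_permutations)
  finally show ?thesis .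
qed

section \<open>From Hermitian to bilinear orthogonality\<close>

lemma poly_map_poly_cnj_of_real:
  "poly (map_poly cnj q) (complex_of_real x) = cnj (poly q (complex_of_real x))"
  using poly_cnj[of q "complex_of_real x"] by simp

lemma monic_orthogonal_degree: "monic_orthogonal \<mu> p \<Longrightarrow> degree (p n) = n"
  by (simp add: monic_orthogonal_def)

lemma monic_orthogonal_coeff: "monic_orthogonal \<mu> p \<Longrightarrow> coeff (p n) n = 1"
  unfolding monic_orthogonal_def by metis

text \<open>On the real line, conjugating values amounts to conjugating coefficients. The conjugates
  of the \<open>p k\<close> with \<open>k < n\<close> are again monic of degree \<open>k\<close>,
  hence span all polynomials of degree below \<open>n\<close>.\<close>

lemma monic_orthogonal_eq_0:
  assumes fm: "finite_moments \<mu>" and p: "monic_orthogonal \<mu> p"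
    and q: "\<And>i. i \<ge> n \<Longrightarrow> coeff q i = 0"
  shows "poly_integral \<mu> (p n * q) = 0"
proof (rule poly_functional_eq_0[where \<psi> = "\<lambda>q. poly_integral \<mu> (p n * q)"])
  show "module_hom Polynomial.smult (*) (\<lambda>q. poly_integral \<mu> (p n * q))"
    using fm by (intro poly_functional_comp_mult poly_functional_poly_integral)
  fix k assume k: "k < n"
  show "degree (map_poly cnj (p k)) = k" "lead_coeff (map_poly cnj (p k)) = 1"
    using p by (simp_all add: monic_orthogonal_degree monic_orthogonal_coeff
        degree_map_poly coeff_map_poly)
  show "poly_integral \<mu> (p n * map_poly cnj (p k)) = 0"
    using p k by (simp add: monic_orthogonal_def poly_integral_def poly_map_poly_cnj_of_real)
qed (fact q)

text \<open>The conjugate of \<open>p n\<close> and \<open>monom 1 n\<close> are both monic of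
  degree \<open>n\<close>, so their difference has lower degree and is orthogonal to
  \<open>p n\<close>.\<close>

lemma norm_sq_eq_poly_integral:
  assumes fm: "finite_moments \<mu>" and p: "monic_orthogonal \<mu> p"
  shows "norm_sq \<mu> (p n) = poly_integral \<mu> (monom 1 n * p n)"
proof -
  interpret module_hom Polynomial.smult "(*)" "poly_integral \<mu>"
    using fm by (rule poly_functional_poly_integral)
  let ?q = "map_poly cnj (p n)"
  have pn: "degree (p n) = n" "coeff (p n) n = 1"
    using p by (rule monic_orthogonal_degree monic_orthogonal_coeff)+
  have "coeff (?q - monom 1 n) i = 0" if "i \<ge> n" for i
    using that pn by (cases "i = n") (auto simp: coeff_map_poly coeff_eq_0)
  then have "poly_integral \<mu> (p n * (?q - monom 1 n)) = 0"
    by (rule monic_orthogonal_eq_0[OF fm p])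
  moreover have "norm_sq \<mu> (p n) = poly_integral \<mu> (p n * ?q)"
    by (simp add: norm_sq_def poly_integral_def poly_map_poly_cnj_of_real)
  ultimately show ?thesis
    by (simp add: right_diff_distrib diff mult.commute)
qed

section \<open>The functionals dual to a canonical sequence\<close>

lemma funpow_canonical_sequence:
  assumes T: "lowers_degree T" and r: "canonical_sequence T u r"
  shows "(T ^^ i) (r k) = (if i \<le> k then r (k - i) else 0)"
proof (induction i)
  case (Suc i)
  have "T (r 0) = 0" "T 0 = 0"
    using T r by (simp_all add: lowers_degree_def canonical_sequence_def)
  moreover have "T (r (k - i)) = r (k - Suc i)" if "i < k"
    using r that by (simp add: canonical_sequence_def)
  ultimately show ?case
    using Suc.IH by (cases i k rule: linorder_cases) auto
qed simp

text \<open>For \<open>i < k\<close> the iterate is some \<open>r l\<close> with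
  \<open>l \<ge> 1\<close>, which vanishes at \<open>u\<close>; for \<open>i = k\<close> it is
  \<open>r 0 = 1\<close>; after that \<open>T\<close> has annihilated the constant.\<close>

lemma poly_funpow_canonical_sequence:
  assumes T: "lowers_degree T" and r: "canonical_sequence T u r"
  shows "poly ((T ^^ i) (r k)) u = (if i = k then 1 else 0)"
  using r by (auto simp: funpow_canonical_sequence[OF T r] canonical_sequence_def)

theorem theorem1p3:
  fixes \<mu> :: "real set \<Rightarrow> real" and u :: complex
    and T :: "complex poly \<Rightarrow> complex poly"
    and r p :: "nat \<Rightarrow> complex poly"
    and \<sigma> a :: "nat \<Rightarrow> complex" and n m :: nat
  assumes "signed_measure \<mu>" and "finite_moments \<mu>"
    and "Vector_Spaces.linear Polynomial.smult Polynomial.smult T" and "lowers_degree T"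
    and "canonical_sequence T u r"
    and "a 1 = u" and "\<sigma> 0 = 1"
    and "\<forall>k\<ge>1. \<forall>x. poly (r k) x = \<sigma> k * (\<Prod>j=1..k. x - a j)"
    and "monic_orthogonal \<mu> p"
  shows "multi_integral \<mu> m
           (\<lambda>x. of_real ((difference_product m x)\<^sup>2) * (\<Prod>j=1..m. poly (r n) (of_real (x j)))) =
         ((- 1) ^ (m * n) * fact m * \<sigma> n ^ m * (\<Prod>j<m. norm_sq \<mu> (p j)) * (\<Prod>j<n. \<sigma> j)) *
         Determinant.det (Matrix.mat n n (\<lambda>(i, j). poly ((T ^^ i) (p (m + j))) u))"
proof -
  note fm = assms(2) and r = assms(5) and p = assms(9)
  let ?L = "poly_integral \<mu>" and ?\<phi> = "\<lambda>i q. poly ((T ^^ i) q) u"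
  \<comment> \<open>\<open>N n\<close> is the monic part of \<open>r n\<close> and serves as
    \<open>g\<close> in \<open>det_Christoffel\<close>.\<close>
  define N where "N = (\<lambda>k. \<Prod>j=1..k. [:- a j, 1:])"
  have deg_N: "degree (N k) = k" and monic_N: "lead_coeff (N k) = 1" for k
    unfolding N_def lead_coeff_prod_monic_linear by (simp_all add: degree_prod_monic_linear)
  have r_eq: "r k = Polynomial.smult (\<sigma> k) (N k)" for k
  proof (cases "k = 0")
    case True
    then show ?thesis using r assms(7) by (simp add: canonical_sequence_def N_def)
  next
    case False
    then have "poly (r k) = poly (Polynomial.smult (\<sigma> k) (N k))"
      using assms(8) by (auto simp: N_def poly_prod)
    then show ?thesis by (simp add: poly_eq_poly_eq_iff)
  qed
  have deg_r: "degree (r k) = k" for k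
    using r by (simp add: canonical_sequence_def)
  have lead_r: "lead_coeff (r k) = \<sigma> k" for k
    using monic_N[of k] by (simp add: r_eq)
  \<comment> \<open>For \<open>k \<ge> 1\<close>, a zero factor would contradict
    \<open>degree (r k) = k\<close>.\<close>
  have \<sigma>: "\<sigma> k \<noteq> 0" for k
    using r deg_r[of k] assms(7) by (cases "k = 0") (auto simp: r_eq)
  have L: "module_hom Polynomial.smult (*) ?L"
    using fm by (rule poly_functional_poly_integral)
  have \<phi>: "module_hom Polynomial.smult (*) (?\<phi> i)" for i
  proof -
    have "T (q + q') = T q + T q'" "T (Polynomial.smult c q) = Polynomial.smult c (T q)" for q q' c
      using assms(3) by (auto simp: Vector_Spaces.linear_iff)
    then have "(T ^^ i) (q + q') = (T ^^ i) q + (T ^^ i) q'"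
      "(T ^^ i) (Polynomial.smult c q) = Polynomial.smult c ((T ^^ i) q)" for q q' c
      by (induction i) auto
    then show ?thesis by (intro poly_functionalI) simp_all
  qed
  have ann: "?\<phi> i (N n * q) = 0" if "i < n" for i q
  proof (rule poly_functional_eq_0[where \<psi> = "\<lambda>q. ?\<phi> i (N n * q)"])
    show "module_hom Polynomial.smult (*) (\<lambda>q. ?\<phi> i (N n * q))"
      by (intro poly_functional_comp_mult \<phi>)
    show "coeff q l = 0" if "l \<ge> Suc (degree q)" for l
      using that by (simp add: coeff_eq_0)
    fix k
    \<comment> \<open>These cofactors form a monic basis adapted to \<open>N n\<close>: the product
      is \<open>N (n + k)\<close>, a multiple of \<open>r (n + k)\<close>, on which the functional
      vanishes as \<open>i < n\<close>.\<close>
    let ?b = "\<Prod>j=n+1..n+k. [:- a j, 1:]"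
    show "degree ?b = k" "lead_coeff ?b = 1"
      unfolding lead_coeff_prod_monic_linear by (simp_all add: degree_prod_monic_linear)
    have "N n * ?b = N (n + k)"
      unfolding N_def by (rule prod.ub_add_nat[symmetric]) simp
    then have "?\<phi> i (r (n + k)) = \<sigma> (n + k) * ?\<phi> i (N n * ?b)"
      using module_hom.scale[OF \<phi>] by (simp add: r_eq)
    then show "?\<phi> i (N n * ?b) = 0"
      using poly_funpow_canonical_sequence[OF assms(4) r] \<open>i < n\<close> \<sigma> by simp
  qed
  have "multi_integral \<mu> m
      (\<lambda>x. of_real ((difference_product m x)\<^sup>2) * (\<Prod>j=1..m. poly (r n) (of_real (x j)))) =
    fact m * Determinant.det (Matrix.mat m m (\<lambda>(i, j). ?L (r n * monom 1 (i + j))))"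
    by (rule multi_integral_Heine[OF fm])
  \<comment> \<open>Every entry carries a factor \<open>\<sigma> n\<close>, whence the power
    \<open>\<sigma> n ^ m\<close>.\<close>
  also have "Matrix.mat m m (\<lambda>(i, j). ?L (r n * monom 1 (i + j))) =
    \<sigma> n \<cdot>\<^sub>m Matrix.mat m m (\<lambda>(i, j). ?L (N n * monom 1 (i + j)))"
    by (rule eq_matI) (auto simp: r_eq module_hom.scale[OF L])
  also have "Determinant.det \<dots> =
    \<sigma> n ^ m * Determinant.det (Matrix.mat m m (\<lambda>(i, j). ?L (N n * monom 1 (i + j))))"
    by simp
  also have "Determinant.det (Matrix.mat m m (\<lambda>(i, j). ?L (N n * monom 1 (i + j)))) =
    (- 1) ^ (m * n) * (\<Prod>j<n. lead_coeff (r j)) * (\<Prod>j<m. ?L (monom 1 j * p j)) *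
    Determinant.det (Matrix.mat n n (\<lambda>(i, j). ?\<phi> i (p (m + j))))"
  proof (rule det_Christoffel[OF L \<phi>])
    show "?L (monom 1 i * p j) = 0" if "i < j" for i j
      using monic_orthogonal_eq_0[OF fm p, of j "monom 1 i"] that by (simp add: mult.commute)
  qed (use p deg_r poly_funpow_canonical_sequence[OF assms(4) r] deg_N monic_N ann in
      \<open>auto simp: monic_orthogonal_degree monic_orthogonal_coeff\<close>)
  finally show ?thesis
    by (simp add: lead_r norm_sq_eq_poly_integral[OF fm p] mult_ac)
qed

end
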